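(* Let $T_q$ be the homogeneous tree in which every vertex has degree $q+1\geq 3$, with vertex set $V$, graph metric $d$, and a fixed root vertex $o\in V$. Let $X\subseteq V$ with $d^*(X)>0$. For each integer $k>0$ there exists $K=K(X,k)>0$ such that whenever $t_1,\ldots,t_k\in\mathbb{N}$ satisfy $t_k\geq\cdots\geq t_2\geq t_1\geq K$, there exists a subset $\{v_0,v_1,\ldots,v_k\}\subseteq X$ with $d(v_0,v_j)=2t_j$ for all $1\leq j\leq k$ and $d(o,v_0)=d(o,v_1)=\cdots=d(o,v_k)$.
   Context: For $n\geq 0$, $S_n=\{y\in V\mid d(o,y)=n\}$. The (upper) density of $X\subseteq V$ is $d^*(X)=\limsup_{n\to\infty}\frac{|X\cap S_n|}{|S_n|}$. *)

theory Defs
  imports "HOL-Analysis.Analysis"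
begin

text \<open>
  Simple graphs, possibly infinite, are given by a vertex set \<open>V\<close> and an adjacency relation \<open>E\<close>.
  The notion of forest in \<open>Graph_Theory.Digraph_Component\<close> is not used: it is meant for
  digraphs, and in a symmetric digraph it already counts the closed walk \<open>a, b, a\<close> as a cycle.
\<close>

definition simple_graph :: "'a set \<Rightarrow> ('a \<Rightarrow> 'a \<Rightarrow> bool) \<Rightarrow> bool" where
  "simple_graph V E \<longleftrightarrow>
     (\<forall>x y. E x y \<longrightarrow> x \<in> V \<and> y \<in> V) \<and> (\<forall>x y. E x y \<longrightarrow> E y x) \<and> (\<forall>x. \<not> E x x)"

definition graph_walk :: "'a set \<Rightarrow> ('a \<Rightarrow> 'a \<Rightarrow> bool) \<Rightarrow> 'a \<Rightarrow> 'a list \<Rightarrow> 'a \<Rightarrow> bool" where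
  "graph_walk V E x p y \<longleftrightarrow>
     p \<noteq> [] \<and> set p \<subseteq> V \<and> successively E p \<and> hd p = x \<and> last p = y"

definition graph_connected :: "'a set \<Rightarrow> ('a \<Rightarrow> 'a \<Rightarrow> bool) \<Rightarrow> bool" where
  "graph_connected V E \<longleftrightarrow> V \<noteq> {} \<and> (\<forall>x\<in>V. \<forall>y\<in>V. \<exists>p. graph_walk V E x p y)"

text \<open>A cycle is listed without repeating its initial vertex at the end.\<close>

definition graph_cycle :: "'a set \<Rightarrow> ('a \<Rightarrow> 'a \<Rightarrow> bool) \<Rightarrow> 'a list \<Rightarrow> bool" where
  "graph_cycle V E c \<longleftrightarrow>
     length c \<ge> 3 \<and> distinct c \<and> set c \<subseteq> V \<and> successively E c \<and> E (last c) (hd c)"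

definition graph_tree :: "'a set \<Rightarrow> ('a \<Rightarrow> 'a \<Rightarrow> bool) \<Rightarrow> bool" where
  "graph_tree V E \<longleftrightarrow>
     simple_graph V E \<and> graph_connected V E \<and> (\<nexists>c. graph_cycle V E c)"

text \<open>Since \<open>q + 1 > 0\<close>, the cardinality condition also forces every neighbourhood to be finite.\<close>

definition homogeneous_tree :: "nat \<Rightarrow> 'a set \<Rightarrow> ('a \<Rightarrow> 'a \<Rightarrow> bool) \<Rightarrow> bool" where
  "homogeneous_tree q V E \<longleftrightarrow> graph_tree V E \<and> (\<forall>x\<in>V. card {y. E x y} = q + 1)"

text \<open>Meaningful for vertices joined by a walk; a walk through \<open>n + 1\<close> vertices has length \<open>n\<close>.\<close>

definition graph_dist :: "'a set \<Rightarrow> ('a \<Rightarrow> 'a \<Rightarrow> bool) \<Rightarrow> 'a \<Rightarrow> 'a \<Rightarrow> nat" where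
  "graph_dist V E x y = (LEAST n. \<exists>p. graph_walk V E x p y \<and> length p = n + 1)"

definition graph_sphere :: "'a set \<Rightarrow> ('a \<Rightarrow> 'a \<Rightarrow> bool) \<Rightarrow> 'a \<Rightarrow> nat \<Rightarrow> 'a set" where
  "graph_sphere V E r n = {y \<in> V. graph_dist V E r y = n}"

definition upper_density :: "'a set \<Rightarrow> ('a \<Rightarrow> 'a \<Rightarrow> bool) \<Rightarrow> 'a \<Rightarrow> 'a set \<Rightarrow> ereal" where
  "upper_density V E r X =
     limsup (\<lambda>n. ereal (real (card (X \<inter> graph_sphere V E r n)) / real (card (graph_sphere V E r n))))"

end

theory Submission
  imports Defs "HOL-Library.Transitive_Closure_Table"
begin

text \<open>
  The descendants of a vertex \<open>u\<close> at depth \<open>h\<close> below it form \<open>q\<close> equal branches, and two of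
  them are at distance \<open>2h\<close> exactly when they lie in different branches. Call a set \<open>T\<close> of
  heights bad if each \<open>x \<in> X\<close> has some \<open>t \<in> T\<close> such that no point of \<open>X\<close> on the sphere of \<open>x\<close>
  is at distance \<open>2t\<close> from \<open>x\<close>. If the height \<open>h\<close> serves as such a \<open>t\<close> for some \<open>x\<close> below \<open>u\<close>,
  then \<open>X\<close> meets only one of the \<open>q\<close> branches. Hence each member of a disjoint family of bad sets
  costs a factor \<open>q\<close>, so \<open>m\<close> disjoint bad sets force the density of \<open>X\<close> to be at most
  \<open>1 / q ^ m\<close>. If no \<open>K\<close> existed, there would be infinitely many pairwise disjoint bad sets.
\<close>

section \<open>Walks and distances in arbitrary graphs\<close>

lemma graph_dist_walk:
  assumes "graph_connected V E" "x \<in> V" "y \<in> V"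
  obtains p where "graph_walk V E x p y" "length p = graph_dist V E x y + 1"
proof -
  obtain p where p: "graph_walk V E x p y"
    using assms unfolding graph_connected_def by blast
  then have "p \<noteq> []" by (simp add: graph_walk_def)
  then have "\<exists>p'. graph_walk V E x p' y \<and> length p' = (length p - 1) + 1"
    using p by (intro exI[of _ p]) (cases p; simp)
  then have "\<exists>p. graph_walk V E x p y \<and> length p = graph_dist V E x y + 1"
    unfolding graph_dist_def by (rule LeastI)
  then show thesis using that by blast
qed

lemma graph_dist_le:
  assumes "graph_walk V E x p y"
  shows "graph_dist V E x y + 1 \<le> length p"
proof -
  have "p \<noteq> []" using assms by (simp add: graph_walk_def)
  then have "graph_dist V E x y \<le> length p - 1"
    unfolding graph_dist_def using assms
    by (intro Least_le exI[of _ p]) (cases p; simp)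
  then show ?thesis using \<open>p \<noteq> []\<close> by (cases p) auto
qed

lemma graph_walk_snoc:
  assumes "graph_walk V E x p y" "E y z" "z \<in> V"
  shows "graph_walk V E x (p @ [z]) z"
  using assms by (auto simp: graph_walk_def successively_append_iff)

text \<open>The tool for bounding distances from below: each edge raises \<open>f\<close> by at most
  1. The \<open>+ 1\<close> appears because \<open>length p\<close> counts vertices, not
  edges.\<close>

lemma lipschitz_along_walk:
  fixes f :: "'a \<Rightarrow> int"
  assumes "\<And>a b. E a b \<Longrightarrow> f b \<le> f a + 1" "graph_walk V E x p y"
  shows "f y - f x + 1 \<le> int (length p)"
proof -
  have "p \<noteq> [] \<Longrightarrow> successively E p \<Longrightarrow> f (last p) - f (hd p) + 1 \<le> int (length p)" for p
  proof (induction p rule: induct_list012)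
    case (3 a b p)
    then show ?case using assms(1)[of a b] by auto
  qed auto
  then show ?thesis using assms(2) by (auto simp: graph_walk_def)
qed

lemma rtrancl_path_successively:
  "rtrancl_path R x p y \<Longrightarrow> successively R (x # p) \<and> last (x # p) = y"
  by (induction rule: rtrancl_path.induct) auto

text \<open>A detour can be shortened to a path without repetitions, and \<open>x\<close> then
  closes it to a cycle. This is where acyclicity enters the proof.\<close>

lemma no_detour_between_neighbours:
  assumes tree: "graph_tree V E" and "E x y" "E x z"
    and detour: "(\<lambda>a b. E a b \<and> a \<noteq> x \<and> b \<noteq> x)\<^sup>*\<^sup>* y z"
  shows "y = z"
proof (rule ccontr)
  assume "y \<noteq> z"
  let ?R = "\<lambda>a b. E a b \<and> a \<noteq> x \<and> b \<noteq> x"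
  have sg: "\<And>a b. E a b \<Longrightarrow> a \<in> V \<and> b \<in> V" "\<And>a b. E a b \<Longrightarrow> E b a" "\<And>a. \<not> E a a"
    using tree by (auto simp: graph_tree_def simple_graph_def)
  obtain p0 where "rtrancl_path ?R y p0 z"
    using detour by (auto simp: rtranclp_eq_rtrancl_path)
  then obtain p where p: "rtrancl_path ?R y p z" "distinct (y # p)"
    by (rule rtrancl_path_distinct)
  have s: "successively ?R (y # p)" "last (y # p) = z"
    using rtrancl_path_successively[OF p(1)] by auto
  have "p \<noteq> []" using s(2) \<open>y \<noteq> z\<close> by auto
  have sE: "successively E (y # p)"
    using s(1) by (rule successively_mono) auto
  \<comment> \<open>A one-vertex list satisfies \<open>successively ?R\<close> vacuously, so the
    conditions on the starting vertex \<open>a\<close> are imposed separately.\<close>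
  have aux: "successively ?R (a # l) \<Longrightarrow> a \<in> V \<Longrightarrow> a \<noteq> x \<Longrightarrow> set (a # l) \<subseteq> V - {x}" for a l
    by (induction l arbitrary: a) (use sg in auto)
  have "set (y # p) \<subseteq> V - {x}"
    using aux[OF s(1)] sg assms(2) by blast
  then have "graph_cycle V E (x # y # p)"
    unfolding graph_cycle_def using p(2) sE s(2) assms(2,3) sg \<open>p \<noteq> []\<close>
    by (auto simp: Suc_le_eq)
  then show False using tree by (auto simp: graph_tree_def)
qed

section \<open>Levels, children and descendants in a rooted homogeneous tree\<close>

locale rooted_homogeneous_tree =
  fixes V :: "'a set" and E :: "'a \<Rightarrow> 'a \<Rightarrow> bool" and r :: 'a and q :: nat
  assumes homogeneous: "homogeneous_tree q V E" and root: "r \<in> V"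
begin

abbreviation level :: "'a \<Rightarrow> nat" where
  "level x \<equiv> graph_dist V E r x"

definition children :: "'a \<Rightarrow> 'a set" where
  "children x = {y. E x y \<and> level y = level x + 1}"

primrec descendants :: "'a \<Rightarrow> nat \<Rightarrow> 'a set" where
  "descendants u 0 = {u}"
| "descendants u (Suc h) = (\<Union>c\<in>children u. descendants c h)"

lemma tree: "graph_tree V E"
  using homogeneous by (simp add: homogeneous_tree_def)

lemma connected: "graph_connected V E"
  using tree by (simp add: graph_tree_def)

lemma E_in_V: "E x y \<Longrightarrow> x \<in> V" "E x y \<Longrightarrow> y \<in> V"
  and E_sym: "E x y \<Longrightarrow> E y x"
  and E_irrefl: "\<not> E x x"
  using tree by (auto simp: graph_tree_def simple_graph_def)

lemma card_neighbours: "x \<in> V \<Longrightarrow> card {y. E x y} = q + 1"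
  using homogeneous by (simp add: homogeneous_tree_def)

lemma finite_neighbours: "x \<in> V \<Longrightarrow> finite {y. E x y}"
  using card_neighbours[of x] by (intro card_ge_0_finite) simp

lemma level_le: assumes "E x y" shows "level y \<le> level x + 1"
proof -
  obtain p where p: "graph_walk V E r p x" "length p = level x + 1"
    using graph_dist_walk[OF connected root E_in_V(1)[OF assms]] .
  show ?thesis
    using graph_dist_le[OF graph_walk_snoc[OF p(1) assms E_in_V(2)[OF assms]]] p(2) by simp
qed

lemma level_root: "level r = 0"
  using graph_dist_le[of V E r "[r]" r] root by (simp add: graph_walk_def)

lemma level_0: assumes "x \<in> V" "level x = 0" shows "x = r"
proof -
  obtain p where "graph_walk V E r p x" "length p = level x + 1"
    using graph_dist_walk[OF connected root assms(1)] .
  then show ?thesis using assms(2) by (auto simp: graph_walk_def length_Suc_conv)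
qed

text \<open>The required vertex is the last but one on a shortest walk from the root.\<close>

lemma lower_neighbour:
  assumes "x \<in> V" "x \<noteq> r"
  obtains y where "E x y" "level x = level y + 1"
proof -
  obtain p where p: "graph_walk V E r p x" "length p = level x + 1"
    using graph_dist_walk[OF connected root assms(1)] .
  have "level x \<noteq> 0" using level_0 assms by blast
  moreover obtain p' where p': "p = p' @ [x]"
    using p by (cases p rule: rev_cases) (auto simp: graph_walk_def)
  ultimately have "p' \<noteq> []" using p(2) by auto
  have w: "graph_walk V E r p' (last p')" and e: "E (last p') x"
    using p(1) p' \<open>p' \<noteq> []\<close> by (auto simp: graph_walk_def successively_append_iff)
  have "level (last p') + 1 \<le> level x"
    using graph_dist_le[OF w] p(2) p' by simp
  with level_le[OF e] have "level x = level (last p') + 1" by simp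
  with E_sym[OF e] show thesis using that by blast
qed

text \<open>A descending path from a vertex other than \<open>x\<close> on a level not above that of \<open>x\<close> avoids \<open>x\<close>.\<close>

lemma root_reachable_avoiding:
  assumes "y \<in> V" "y \<noteq> x" "level y \<le> level x"
  shows "(\<lambda>a b. E a b \<and> a \<noteq> x \<and> b \<noteq> x)\<^sup>*\<^sup>* y r"
  using assms
proof (induction "level y" arbitrary: y)
  case 0
  then show ?case using level_0[of y] by simp
next
  case (Suc n)
  then have "y \<noteq> r" using level_root by auto
  then obtain z where z: "E y z" "level y = level z + 1"
    using lower_neighbour Suc.prems by blast
  have "z \<noteq> x" using z Suc.prems by auto
  then have "(\<lambda>a b. E a b \<and> a \<noteq> x \<and> b \<noteq> x)\<^sup>*\<^sup>* z r"
    using Suc z E_in_V by auto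
  then show ?case
    using z \<open>z \<noteq> x\<close> Suc.prems by (intro converse_rtranclp_into_rtranclp[of _ y z]) auto
qed

text \<open>Both neighbours reach the root avoiding \<open>x\<close>, so joining the two paths gives
  a detour between them. As equal levels are allowed, this also rules out edges within a level: away
  from the root, every neighbour except the parent is a child.\<close>

lemma lower_neighbour_unique:
  assumes "E x y" "E x z" "level y \<le> level x" "level z \<le> level x"
  shows "y = z"
proof -
  let ?R = "\<lambda>a b. E a b \<and> a \<noteq> x \<and> b \<noteq> x"
  have ne: "y \<noteq> x" "z \<noteq> x" using assms E_irrefl by auto
  have "?R\<^sup>*\<^sup>* y r" "?R\<^sup>*\<^sup>* z r"
    using root_reachable_avoiding assms ne E_in_V by blast+
  moreover have "symp ?R" using E_sym by (auto intro: sympI)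
  then have "symp ?R\<^sup>*\<^sup>*" by (rule symp_rtranclp)
  ultimately have "?R\<^sup>*\<^sup>* y z"
    by (meson rtranclp_trans sympD)
  then show ?thesis
    using no_detour_between_neighbours[OF tree assms(1,2)] by blast
qed

lemma children_in_V: "x \<in> children u \<Longrightarrow> x \<in> V"
  by (auto simp: children_def E_in_V)

lemma finite_children: "u \<in> V \<Longrightarrow> finite (children u)"
  unfolding children_def using finite_neighbours by (rule rev_finite_subset) auto

lemma root_notin_children: "r \<notin> children u"
  by (simp add: children_def level_root)

lemma children_eq_imp_parent_eq: "x \<in> children u \<Longrightarrow> x \<in> children w \<Longrightarrow> u = w"
  unfolding children_def using lower_neighbour_unique[of x u w] E_sym by auto

lemma card_children:
  assumes "u \<in> V" "u \<noteq> r"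
  shows "card (children u) = q"
proof -
  obtain w where w: "E u w" "level u = level w + 1"
    using lower_neighbour assms by blast
  have "children u = {y. E u y} - {w}"
  proof -
    have "level y = level u + 1" if "E u y" "y \<noteq> w" for y
      using that w level_le[of u y] lower_neighbour_unique[of u y w] by force
    then show ?thesis using w by (auto simp: children_def)
  qed
  then show ?thesis
    using w card_neighbours[OF assms(1)] finite_neighbours[OF assms(1)] by simp
qed

lemma descendants_in_V: "u \<in> V \<Longrightarrow> descendants u h \<subseteq> V"
  by (induction h arbitrary: u) (use children_in_V in auto)

lemma finite_descendants: "u \<in> V \<Longrightarrow> finite (descendants u h)"
proof (induction h arbitrary: u)
  case (Suc h)
  then show ?case using finite_children[of u] children_in_V[of _ u] by auto
qed simp

lemma level_descendants: "x \<in> descendants u h \<Longrightarrow> level x = level u + h"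
  by (induction h arbitrary: u) (auto simp: children_def)

text \<open>The definition splits off the first generation; this form splits off the last one, where
  uniqueness of parents can be applied.\<close>

lemma descendants_Suc: "descendants u (Suc h) = (\<Union>x\<in>descendants u h. children x)"
proof (induction h arbitrary: u)
  case (Suc h)
  have "descendants u (Suc (Suc h)) = (\<Union>c\<in>children u. \<Union>x\<in>descendants c h. children x)"
    using Suc.IH by simp
  then show ?case by simp
qed simp

lemma descendants_disjoint:
  "x \<in> descendants u h \<Longrightarrow> x \<in> descendants w h \<Longrightarrow> u = w"
proof (induction h arbitrary: x)
  case (Suc h)
  then show ?case
    by (simp add: descendants_Suc del: descendants.simps) (metis children_eq_imp_parent_eq)
qed simp

lemma sphere_eq_descendants: "graph_sphere V E r n = descendants r n"
proof (intro equalityI subsetI)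
  fix x assume "x \<in> graph_sphere V E r n"
  then show "x \<in> descendants r n"
  proof (induction n arbitrary: x)
    case 0
    then show ?case using level_0 by (simp add: graph_sphere_def)
  next
    case (Suc n)
    then have x: "x \<in> V" "level x = Suc n" by (auto simp: graph_sphere_def)
    then have "x \<noteq> r" using level_root by auto
    then obtain y where y: "E x y" "level x = level y + 1"
      using lower_neighbour x by blast
    then have "y \<in> descendants r n" "x \<in> children y"
      using Suc.IH x E_in_V E_sym by (auto simp: graph_sphere_def children_def)
    then show ?case by (auto simp: descendants_Suc simp del: descendants.simps)
  qed
next
  fix x assume "x \<in> descendants r n"
  then show "x \<in> graph_sphere V E r n"
    using level_descendants[of x r n] descendants_in_V[OF root] level_root
    by (auto simp: graph_sphere_def)
qed

lemma card_Int_descendants_Suc: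
  assumes "u \<in> V"
  shows "card (X \<inter> descendants u (Suc h)) = (\<Sum>c\<in>children u. card (X \<inter> descendants c h))"
proof -
  have "X \<inter> descendants u (Suc h) = (\<Union>c\<in>children u. X \<inter> descendants c h)"
    by auto
  moreover have "card (\<Union>c\<in>children u. X \<inter> descendants c h)
      = (\<Sum>c\<in>children u. card (X \<inter> descendants c h))"
    using assms finite_children finite_descendants children_in_V descendants_disjoint
    by (intro card_UN_disjoint) blast+
  ultimately show ?thesis by simp
qed

lemma card_descendants:
  assumes "u \<in> V" "u \<noteq> r"
  shows "card (descendants u h) = q ^ h"
  using assms
proof (induction h arbitrary: u)
  case (Suc h)
  have "card (descendants u (Suc h)) = (\<Sum>c\<in>children u. card (descendants c h))"
    using card_Int_descendants_Suc[OF Suc.prems(1), of UNIV] by simp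
  also have "\<dots> = (\<Sum>c\<in>children u. q ^ h)"
    using children_in_V root_notin_children by (intro sum.cong refl Suc.IH) blast+
  finally show ?case using card_children Suc.prems by simp
qed simp

section \<open>Distances between descendants of a common vertex\<close>

lemma descendants_walk:
  assumes "u \<in> V" "x \<in> descendants u h"
  shows "\<exists>p. graph_walk V E u p x \<and> length p = h + 1"
  using assms(2)
proof (induction h arbitrary: x)
  case 0
  then show ?case using assms(1) by (intro exI[of _ "[u]"]) (auto simp: graph_walk_def)
next
  case (Suc h)
  then obtain y where y: "y \<in> descendants u h" "x \<in> children y"
    by (auto simp: descendants_Suc simp del: descendants.simps)
  then obtain p where "graph_walk V E u p y" "length p = h + 1"
    using Suc.IH by blast
  then show ?case
    using graph_walk_snoc[of V E u p y x] y(2) children_in_V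
    by (intro exI[of _ "p @ [x]"]) (auto simp: children_def)
qed

lemma dist_descendants_le:
  assumes "u \<in> V" "v \<in> descendants u h" "w \<in> descendants u h"
  shows "graph_dist V E v w \<le> 2 * h"
proof -
  obtain p p' where p: "graph_walk V E u p v" "length p = h + 1"
    and p': "graph_walk V E u p' w" "length p' = h + 1"
    using descendants_walk assms by metis
  obtain s where s: "p' = u # s"
    using p'(1) by (cases p') (auto simp: graph_walk_def)
  have "successively (\<lambda>x y. E y x) p"
    using p(1) E_sym unfolding graph_walk_def by (blast intro: successively_mono)
  \<comment> \<open>Climb from \<open>v\<close> to \<open>u\<close>, then descend to
    \<open>w\<close>; \<open>s\<close> omits \<open>u\<close>, so the walk has
    \<open>2 * h + 1\<close> vertices.\<close>
  then have "graph_walk V E v (rev p @ s) w"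
    using p(1) p'(1) unfolding s graph_walk_def
    by (auto simp: successively_append_iff successively_rev successively_Cons hd_rev last_rev)
  then show ?thesis using p(2) p'(2) s by (auto dest!: graph_dist_le)
qed

text \<open>
  The height function measured along the path from the branch of \<open>c\<close> through \<open>u\<close> to the rest
  of the tree is 1-Lipschitz, since the edge from \<open>c\<close> to \<open>u\<close> is the only one leaving the branch.
\<close>

lemma dist_across_branches:
  assumes "u \<in> V" "c \<in> children u" "c' \<in> children u" "c \<noteq> c'"
    and v: "v \<in> descendants c h" and w: "w \<in> descendants c' h"
  shows "graph_dist V E v w = 2 * Suc h"
proof (rule antisym)
  show "graph_dist V E v w \<le> 2 * Suc h"
    by (rule dist_descendants_le[OF assms(1)]) (use assms in auto)
next
  define D where "D = (\<Union>h. descendants c h)"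
  define f where "f x = (if x \<in> D then int (level u) - int (level x)
    else int (level x) - int (level u))" for x
  have lc: "level c = level u + 1" "level c' = level u + 1" "E c u"
    using assms E_sym by (auto simp: children_def)
  have exit: "x = c \<and> y = u" if x: "x \<in> D" and "y \<notin> D" and e: "E x y" for x y
  proof -
    obtain i where i: "x \<in> descendants c i" using x by (auto simp: D_def)
    have "y \<notin> children x"
    proof
      assume "y \<in> children x"
      then have "y \<in> descendants c (Suc i)"
        using i unfolding descendants_Suc by blast
      then show False using \<open>y \<notin> D\<close> unfolding D_def by blast
    qed
    then have ly: "level y \<le> level x" using e level_le[OF e] by (auto simp: children_def)
    \<comment> \<open>Since \<open>y\<close> is not above \<open>x\<close> in level, it is the
      parent of \<open>x\<close>: this is \<open>u\<close> if \<open>x\<close> is \<open>c\<close>,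
      and otherwise it still lies in \<open>D\<close>.\<close>
    show ?thesis
    proof (cases i)
      case 0
      then show ?thesis using i e ly lc lower_neighbour_unique[of c y u] by auto
    next
      case (Suc j)
      then obtain z where z: "z \<in> descendants c j" "x \<in> children z"
        using i unfolding Suc descendants_Suc by blast
      then have "y = z"
        using lower_neighbour_unique[of x y z] e ly E_sym by (auto simp: children_def)
      then show ?thesis using z(1) \<open>y \<notin> D\<close> by (auto simp: D_def)
    qed
  qed
  have lip: "f b \<le> f a + 1" if e: "E a b" for a b
    using level_le[OF e] level_le[OF E_sym[OF e]] exit[of a b] exit[of b a] e E_sym[OF e] lc
    by (auto simp: f_def)
  have "v \<in> D" using v by (auto simp: D_def)
  moreover have "w \<notin> D"
  proof
    assume "w \<in> D"
    \<comment> \<open>Comparing levels forces \<open>w\<close> to have depth \<open>h\<close> below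
      both \<open>c\<close> and \<open>c'\<close>, which contradicts disjointness.\<close>
    then obtain i where i: "w \<in> descendants c i" by (auto simp: D_def)
    then have "i = h" using level_descendants[OF i] level_descendants[OF w] lc by simp
    then show False using descendants_disjoint i w assms(4) by blast
  qed
  \<comment> \<open>\<open>f\<close> runs from \<open>- Suc h\<close> at \<open>v\<close> to
    \<open>Suc h\<close> at \<open>w\<close>.\<close>
  ultimately have f: "f w - f v = 2 * int (Suc h)"
    using level_descendants[OF v] level_descendants[OF w] lc by (simp add: f_def)
  have "v \<in> V" "w \<in> V"
    using v w assms(2,3) children_in_V descendants_in_V by blast+
  then obtain p where p: "graph_walk V E v p w" "length p = graph_dist V E v w + 1"
    using graph_dist_walk[OF connected] by metis
  show "2 * Suc h \<le> graph_dist V E v w"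
    using lipschitz_along_walk[of E f, OF lip p(1)] f p(2) by simp
qed

section \<open>Bad sets of heights and the density of \<open>X\<close>\<close>

text \<open>Induction on \<open>h\<close>. If the top height is the failing one for some
  \<open>x\<close> and \<open>T\<close>, then \<open>X\<close> lives in a single branch and
  \<open>T\<close> is given up: one factor \<open>q\<close> is lost on the left and one on the
  right. Otherwise all failures occur at smaller heights, the hypothesis passes to each of the
  \<open>q\<close> branches, and the bounds add up.\<close>

lemma card_Int_descendants_le:
  assumes "u \<in> V" "u \<noteq> r" "finite F" "disjoint F" "0 \<notin> \<Union>F"
    and "\<And>x T. x \<in> X \<inter> descendants u h \<Longrightarrow> T \<in> F \<Longrightarrow>
      \<exists>t\<in>T. t \<le> h \<and> (\<forall>y\<in>X \<inter> descendants u h. graph_dist V E x y \<noteq> 2 * t)"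
  shows "q ^ card F * card (X \<inter> descendants u h) \<le> q ^ h"
  using assms
proof (induction h arbitrary: u F)
  case 0
  show ?case
  proof (cases "u \<in> X")
    case True
    \<comment> \<open>At depth 0 a failing height could only be 0, which is excluded from the
      members of \<open>F\<close>.\<close>
    then have "F = {}" using 0(5) 0(6)[of u] by fastforce
    then show ?thesis by (simp add: True)
  qed simp
next
  case (Suc h)
  note bad = Suc.prems(6)
  show ?case
  proof (cases "\<exists>x\<in>X \<inter> descendants u (Suc h). \<exists>T\<in>F. Suc h \<in> T \<and>
      (\<forall>y\<in>X \<inter> descendants u (Suc h). graph_dist V E x y \<noteq> 2 * Suc h)")
    case True
    then obtain x T where x: "x \<in> X" "x \<in> descendants u (Suc h)" and T: "T \<in> F" "Suc h \<in> T"
      and lonely: "\<And>y. y \<in> X \<inter> descendants u (Suc h) \<Longrightarrow> graph_dist V E x y \<noteq> 2 * Suc h"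
      by blast
    obtain c where c: "c \<in> children u" "x \<in> descendants c h" using x by auto
    \<comment> \<open>A point of \<open>X\<close> in another branch would be at distance exactly
      \<open>2 * Suc h\<close> from \<open>x\<close>.\<close>
    have X_eq: "X \<inter> descendants u (Suc h) = X \<inter> descendants c h"
      using lonely c dist_across_branches[OF Suc.prems(1) c(1) _ _ c(2)] by fastforce
    have "q ^ card (F - {T}) * card (X \<inter> descendants c h) \<le> q ^ h"
    proof (rule Suc.IH)
      show "disjoint (F - {T})" using Suc.prems(4) by (auto simp: pairwise_def)
      fix y T' assume y: "y \<in> X \<inter> descendants c h" and T': "T' \<in> F - {T}"
      obtain t where t: "t \<in> T'" "t \<le> Suc h"
        "\<forall>z\<in>X \<inter> descendants c h. graph_dist V E y z \<noteq> 2 * t"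
        using bad[of y T'] y T' X_eq by auto
      \<comment> \<open>Disjointness keeps the height \<open>Suc h\<close> out of the remaining
        sets, so their failing heights are at most \<open>h\<close>.\<close>
      have "T' \<inter> T = {}" using Suc.prems(4) T(1) T' by (auto simp: pairwise_def disjnt_def)
      then have "t \<noteq> Suc h" using t(1) T(2) by blast
      then show "\<exists>t\<in>T'. t \<le> h \<and> (\<forall>z\<in>X \<inter> descendants c h. graph_dist V E y z \<noteq> 2 * t)"
        using t by (intro bexI[of _ t]) auto
    qed (use Suc.prems c children_in_V root_notin_children in auto)
    moreover have "card F = Suc (card (F - {T}))"
      using T(1) Suc.prems(3) by (rule card.remove[rotated])
    ultimately show ?thesis unfolding X_eq by (simp add: mult.assoc)
  next
    case False
    have branch: "q ^ card F * card (X \<inter> descendants c h) \<le> q ^ h" if c: "c \<in> children u" for c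
    proof (rule Suc.IH)
      fix y T assume y: "y \<in> X \<inter> descendants c h" and T: "T \<in> F"
      have y': "y \<in> X \<inter> descendants u (Suc h)" using y c by auto
      obtain t where t: "t \<in> T" "t \<le> Suc h"
        "\<forall>z\<in>X \<inter> descendants u (Suc h). graph_dist V E y z \<noteq> 2 * t"
        using bad[OF y' T] by blast
      then have "t \<noteq> Suc h" using False y' T by blast
      then show "\<exists>t\<in>T. t \<le> h \<and> (\<forall>z\<in>X \<inter> descendants c h. graph_dist V E y z \<noteq> 2 * t)"
        using t c by (intro bexI[of _ t]) auto
    qed (use Suc.prems c children_in_V root_notin_children in auto)
    have "q ^ card F * card (X \<inter> descendants u (Suc h))
        = (\<Sum>c\<in>children u. q ^ card F * card (X \<inter> descendants c h))"
      unfolding card_Int_descendants_Suc[OF Suc.prems(1)] by (rule sum_distrib_left)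
    also have "\<dots> \<le> (\<Sum>c\<in>children u. q ^ h)"
      by (rule sum_mono) (rule branch)
    also have "\<dots> = q ^ Suc h" using card_children Suc.prems by simp
    finally show ?thesis .
  qed
qed

text \<open>Only the values of a sequence of heights matter here, hence a set \<open>T\<close>; the
  failing \<open>t\<close> may depend on \<open>x\<close>.\<close>

definition bad :: "'a set \<Rightarrow> nat set \<Rightarrow> bool" where
  "bad X T \<longleftrightarrow> (\<forall>n. \<forall>x\<in>X \<inter> graph_sphere V E r n. \<exists>t\<in>T.
     \<forall>y\<in>X \<inter> graph_sphere V E r n. graph_dist V E x y \<noteq> 2 * t)"

text \<open>The root has one child more than other vertices, so the previous bound is applied below
  each of its children and summed. Heights up to \<open>h\<close> never require branching at the
  root itself.\<close>

lemma card_Int_sphere_le: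
  assumes "finite F" "disjoint F" "0 \<notin> \<Union>F" "\<And>T. T \<in> F \<Longrightarrow> bad X T"
    and "\<And>t. t \<in> \<Union>F \<Longrightarrow> t \<le> h"
  shows "q ^ card F * card (X \<inter> graph_sphere V E r (Suc h)) \<le> card (graph_sphere V E r (Suc h))"
proof -
  have branch: "q ^ card F * card (X \<inter> descendants c h) \<le> q ^ h" if c: "c \<in> children r" for c
  proof (rule card_Int_descendants_le)
    fix y T assume y: "y \<in> X \<inter> descendants c h" and T: "T \<in> F"
    have y': "y \<in> X \<inter> graph_sphere V E r (Suc h)"
      using y c by (auto simp: sphere_eq_descendants)
    obtain t where t: "t \<in> T"
      "\<forall>z\<in>X \<inter> graph_sphere V E r (Suc h). graph_dist V E y z \<noteq> 2 * t"
      using assms(4)[OF T] y' unfolding bad_def by blast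
    then show "\<exists>t\<in>T. t \<le> h \<and> (\<forall>z\<in>X \<inter> descendants c h. graph_dist V E y z \<noteq> 2 * t)"
      using c T assms(5)[of t] by (intro bexI[of _ t]) (auto simp: sphere_eq_descendants)
  qed (use assms c children_in_V root_notin_children in auto)
  have "q ^ card F * card (X \<inter> graph_sphere V E r (Suc h))
      = (\<Sum>c\<in>children r. q ^ card F * card (X \<inter> descendants c h))"
    unfolding sphere_eq_descendants card_Int_descendants_Suc[OF root] by (rule sum_distrib_left)
  also have "\<dots> \<le> (\<Sum>c\<in>children r. q ^ h)"
    by (rule sum_mono) (rule branch)
  also have "\<dots> = (\<Sum>c\<in>children r. card (descendants c h))"
  proof (intro sum.cong refl)
    fix c assume "c \<in> children r"
    then have "c \<in> V" "c \<noteq> r" using children_in_V root_notin_children by auto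
    then show "q ^ h = card (descendants c h)" using card_descendants by simp
  qed
  also have "\<dots> = card (graph_sphere V E r (Suc h))"
    using card_Int_descendants_Suc[OF root, of UNIV] by (simp add: sphere_eq_descendants)
  finally show ?thesis .
qed

lemma upper_density_le:
  assumes F: "finite F" "disjoint F" "0 \<notin> \<Union>F" "\<And>T. T \<in> F \<Longrightarrow> bad X T" "\<And>T. T \<in> F \<Longrightarrow> finite T"
    and "q > 0"
  shows "upper_density V E r X \<le> ereal (1 / real q ^ card F)"
proof -
  have "finite (\<Union>F)" using F by blast
  then have "\<exists>N. \<forall>t\<in>\<Union>F. t \<le> N" by (simp only: finite_nat_set_iff_bounded_le)
  then obtain N where N: "\<And>t. t \<in> \<Union>F \<Longrightarrow> t \<le> N" by blast
  have "real (card (X \<inter> graph_sphere V E r n)) / real (card (graph_sphere V E r n))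
      \<le> 1 / real q ^ card F" if n: "n \<ge> Suc N" for n
  proof -
    let ?a = "card (X \<inter> graph_sphere V E r n)" and ?b = "card (graph_sphere V E r n)"
    obtain h where "n = Suc h" "N \<le> h" using n by (auto dest: Suc_le_D)
    then have "q ^ card F * ?a \<le> ?b"
      using card_Int_sphere_le[of F X h] F N order_trans by blast
    then have "real q ^ card F * real ?a \<le> real ?b"
      by (metis of_nat_le_iff of_nat_mult of_nat_power)
    then show ?thesis
      \<comment> \<open>For \<open>?b = 0\<close> the quotient is 0 by the convention for division
        by zero.\<close>
      using \<open>q > 0\<close> by (cases "?b = 0") (auto simp: field_simps)
  qed
  then show ?thesis
    unfolding upper_density_def
    by (intro Limsup_bounded) (auto simp: eventually_sequentially intro!: exI[of _ "Suc N"])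
qed

section \<open>Choice of disjoint bad sets and the final contradiction\<close>

text \<open>Each new bad set is taken beyond all heights used so far. Starting at
  \<open>Suc N\<close> also keeps 0 out.\<close>

lemma disjoint_bad_family:
  assumes "\<And>K. K > 0 \<Longrightarrow> \<exists>T. finite T \<and> T \<noteq> {} \<and> T \<subseteq> {K..} \<and> bad X T"
  shows "\<exists>F. card F = m \<and> finite F \<and> disjoint F \<and> 0 \<notin> \<Union>F \<and> (\<forall>T\<in>F. finite T \<and> bad X T)"
proof (induction m)
  case 0
  show ?case by (intro exI[of _ "{}"]) simp
next
  case (Suc m)
  then obtain F where F: "card F = m" "finite F" "disjoint F" "0 \<notin> \<Union>F"
    "\<And>T. T \<in> F \<Longrightarrow> finite T \<and> bad X T" by blast
  have "finite (\<Union>F)" using F by blast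
  then have "\<exists>N. \<forall>t\<in>\<Union>F. t \<le> N" by (simp only: finite_nat_set_iff_bounded_le)
  then obtain N where N: "\<And>t. t \<in> \<Union>F \<Longrightarrow> t \<le> N" by blast
  obtain T where T: "finite T" "T \<noteq> {}" "T \<subseteq> {Suc N..}" "bad X T"
    using assms[of "Suc N"] by auto
  have disj: "T \<inter> T' = {}" if "T' \<in> F" for T'
    using N T(3) that by fastforce
  then have "T \<notin> F" using T(2) by blast
  moreover have "disjoint (insert T F)"
    using F(3) disj by (auto simp: pairwise_insert disjnt_def)
  ultimately show ?case
    using F T by (intro exI[of _ "insert T F"]) auto
qed

end

theorem theorem1:
  fixes V :: "'a set" and E :: "'a \<Rightarrow> 'a \<Rightarrow> bool" and r :: 'a
    and X :: "'a set" and q k :: nat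
  assumes "homogeneous_tree q V E" and "q + 1 \<ge> 3"
    and "r \<in> V"
    and "X \<subseteq> V" and "upper_density V E r X > 0"
    and "k > 0"
  shows "\<exists>K::nat. K > 0 \<and>
    (\<forall>t::nat \<Rightarrow> nat. mono_on {1..k} t \<and> t 1 \<ge> K \<longrightarrow>
      (\<exists>v::nat \<Rightarrow> 'a. v ` {0..k} \<subseteq> X \<and>
        (\<forall>j\<in>{1..k}. graph_dist V E (v 0) (v j) = 2 * t j) \<and>
        (\<forall>j\<in>{1..k}. graph_dist V E r (v j) = graph_dist V E r (v 0))))"
proof (rule ccontr)
  assume neg: "\<not> ?thesis"
  interpret rooted_homogeneous_tree V E r q
    by (rule rooted_homogeneous_tree.intro) fact+
  have "\<exists>T. finite T \<and> T \<noteq> {} \<and> T \<subseteq> {K..} \<and> bad X T" if K: "K > 0" for K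
  proof -
    obtain t where mono: "mono_on {1..k} t" and "t 1 \<ge> K"
      and none: "\<nexists>v. v ` {0..k} \<subseteq> X \<and> (\<forall>j\<in>{1..k}. graph_dist V E (v 0) (v j) = 2 * t j) \<and>
        (\<forall>j\<in>{1..k}. graph_dist V E r (v j) = graph_dist V E r (v 0))"
      using neg K by blast
    have "t j \<ge> K" if "j \<in> {1..k}" for j
      using mono_onD[OF mono, of 1 j] that \<open>t 1 \<ge> K\<close> by auto
    moreover have "bad X (t ` {1..k})"
    proof (rule ccontr)
      assume "\<not> ?thesis"
      \<comment> \<open>If the set of values is not bad, some \<open>x\<close> has a partner in
        \<open>X\<close> on its own sphere for every \<open>t j\<close>; \<open>x\<close> and these
        partners form the excluded configuration.\<close>
      then have "\<exists>n. \<exists>x\<in>X \<inter> graph_sphere V E r n. \<forall>j\<in>{1..k}.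
          \<exists>y\<in>X \<inter> graph_sphere V E r n. graph_dist V E x y = 2 * t j"
        by (simp only: bad_def ball_simps bex_simps not_all not_not)
      then obtain n x where x: "x \<in> X \<inter> graph_sphere V E r n"
        and all: "\<forall>j\<in>{1..k}. \<exists>y\<in>X \<inter> graph_sphere V E r n. graph_dist V E x y = 2 * t j"
        by (elim exE bexE)
      obtain w where w: "\<And>j. j \<in> {1..k} \<Longrightarrow>
          w j \<in> X \<inter> graph_sphere V E r n \<and> graph_dist V E x (w j) = 2 * t j"
        using bchoice[OF all[unfolded Bex_def]] by blast
      define v where "v j = (if j = 0 then x else w j)" for j :: nat
      have "v ` {0..k} \<subseteq> X" using x w by (auto simp: v_def)
      moreover have "\<forall>j\<in>{1..k}. graph_dist V E (v 0) (v j) = 2 * t j"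
        using w by (auto simp: v_def)
      moreover have "\<forall>j\<in>{1..k}. graph_dist V E r (v j) = graph_dist V E r (v 0)"
        using x w by (auto simp: v_def graph_sphere_def)
      ultimately show False using none by blast
    qed
    ultimately show ?thesis using \<open>k > 0\<close> by (intro exI[of _ "t ` {1..k}"]) auto
  qed
  note family = disjoint_bad_family[OF this]
  \<comment> \<open>A real number strictly below the density; as \<open>q\<close> is at least 2,
    enough disjoint bad sets push the upper bound below it.\<close>
  obtain e where e: "0 < ereal e" "ereal e < upper_density V E r X"
    using ereal_dense2[OF assms(5)] by blast
  have "1 / real q < 1" using assms(2) by simp
  then obtain m where m: "(1 / real q) ^ m < e"
    using real_arch_pow_inv[of e "1 / real q"] e(1) by auto
  obtain F where F: "card F = m" "finite F" "disjoint F" "0 \<notin> \<Union>F"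
    "\<And>T. T \<in> F \<Longrightarrow> finite T" "\<And>T. T \<in> F \<Longrightarrow> bad X T"
    using family[of m] by blast
  have "upper_density V E r X \<le> ereal (1 / real q ^ card F)"
    using assms(2) by (intro upper_density_le F) auto
  also have "\<dots> < ereal e" using m F(1) by (simp add: power_one_over)
  finally show False using e(2) by simp
qed

end
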